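(* For every positive integer $n$, there is a biased partition of $\mathbb{Z}^n$, i.e. a partition $\{X_i\}_{i\in[2n]}$ of $\mathbb{Z}^n$ into $2n$ sets such that every $x\in\mathbb{Z}^n$ has exactly one neighbour in $X_i$ for each $i\in[2n]$.
   Context: $[k]=\{1,\dots,k\}$. $\mathbb{Z}^n$ is regarded as the graph with edges $\{x,x+e_i\}$ for $x\in\mathbb{Z}^n$, $i\in[n]$, where $e_i$ is the $i$-th standard basis vector; $\Gamma(x)=\{x\pm e_i: i\in[n]\}$ is the neighbourhood of $x$. A set $X\subseteq\mathbb{Z}^n$ is $p$-biased if $|\Gamma(x)\cap X|=2pn$ for all $x\in\mathbb{Z}^n$. A partition $\{X_i\}_{i\in[2n]}$ of $\mathbb{Z}^n$ is biased if each $X_i$ is $\frac{1}{2n}$-biased. *)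

theory Defs
  imports "HOL-Analysis.Finite_Cartesian_Product" "HOL-Library.Disjoint_Sets"
begin

text \<open>
  The lattice \<open>\<int>\<^sup>n\<close> is the type \<^typ>\<open>int ^ 'n\<close> with \<open>n = CARD('n)\<close>; every positive integer
  arises as \<open>CARD('n)\<close> for some finite type \<open>'n\<close>. The standard basis vector \<open>e\<^sub>i\<close> is \<open>axis i 1\<close>.
\<close>

definition nbhd :: "int ^ 'n \<Rightarrow> (int ^ 'n) set" where
  "nbhd x = (\<Union>i\<in>UNIV. {x + axis i 1, x - axis i 1})"

definition is_biased :: "real \<Rightarrow> (int ^ 'n) set \<Rightarrow> bool" where
  "is_biased p X \<longleftrightarrow> (\<forall>x. real (card (nbhd x \<inter> X)) = 2 * p * real CARD('n))"

text \<open>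
  Injectivity on the index set makes \<open>X\<close> a partition as an indexed family: distinct indices
  give distinct, hence disjoint, parts.
\<close>

definition biased_partition :: "(nat \<Rightarrow> (int ^ 'n) set) \<Rightarrow> bool" where
  "biased_partition X \<longleftrightarrow>
     inj_on X {1..2 * CARD('n)} \<and>
     partition_on UNIV (X ` {1..2 * CARD('n)}) \<and>
     (\<forall>i\<in>{1..2 * CARD('n)}. is_biased (1 / (2 * real CARD('n))) (X i))"

end

theory Submission
  imports Defs
begin

text \<open>
  Number the coordinates \<open>0, \<dots>, n - 1\<close> and let \<open>h x = \<Sum>\<^sub>i (2 i + 1) x\<^sub>i\<close>. Moving from \<open>x\<close> to its
  \<open>2 n\<close> neighbours changes \<open>h\<close> by the numbers \<open>\<plusminus>1, \<plusminus>3, \<dots>, \<plusminus>(2 n - 1)\<close>, which represent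
  each odd residue modulo \<open>4 n\<close> exactly once. So \<open>h\<close> takes on the neighbours of \<open>x\<close> each residue
  modulo \<open>4 n\<close> of parity opposite to \<open>h x\<close> exactly once, and merging the residues \<open>2 k\<close> and
  \<open>2 k + 1\<close> into one class yields the required \<open>2 n\<close> classes.
\<close>

text \<open>Treating both directions along an axis as one step with sign \<open>s\<close> avoids a
  case split when the change of a linear form is computed.\<close>

lemma in_nbhd_iff:
  fixes x y :: "int ^ 'n::finite"
  shows "y \<in> nbhd x \<longleftrightarrow> (\<exists>i. \<exists>s\<in>{1, -1}. y = x + axis i s)"
proof -
  have "axis i (- 1 :: int) = - axis i 1" for i :: 'n
    by (simp add: vec_eq_iff axis_def)
  then show ?thesis
    by (auto simp: nbhd_def)
qed

lemma sum_mult_add_axis: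
  fixes a :: "'n::finite \<Rightarrow> int"
  shows "(\<Sum>j\<in>UNIV. a j * (x + axis i s) $ j) = (\<Sum>j\<in>UNIV. a j * x $ j) + a i * s"
proof -
  have "(\<Sum>j\<in>UNIV. a j * axis i s $ j) = (\<Sum>j\<in>UNIV. if j = i then a j * s else 0)"
    by (rule sum.cong) (auto simp: axis_def)
  then show ?thesis
    by (simp add: distrib_left sum.distrib)
qed

text \<open>An odd residue \<open>e\<close> below \<open>2 * n\<close> is itself some
  \<open>2 * m + 1\<close>. For a larger one, \<open>4 * n - e\<close> is odd and below
  \<open>2 * n\<close>, so the sign -1 reaches it.\<close>

lemma odd_residue_exists:
  fixes n d :: int
  assumes n: "n > 0" and d: "odd d"
  shows "\<exists>m s. 0 \<le> m \<and> m < n \<and> s \<in> {1, -1} \<and> 4 * n dvd d - (2 * m + 1) * s"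
proof -
  define e where "e = d mod (4 * n)"
  have e: "0 \<le> e" "e < 4 * n" "odd e" and dvd: "4 * n dvd d - e"
    using n d by (auto simp: e_def dvd_mod_iff minus_mod_eq_mult_div)
  show ?thesis
  proof (cases "e < 2 * n")
    case True
    from \<open>odd e\<close> obtain m where "e = 2 * m + 1" by (elim oddE)
    then show ?thesis
      using True e dvd by (intro exI[of _ m] exI[of _ 1]) auto
  next
    case False
    from \<open>odd e\<close> have "odd (4 * n - e)" by simp
    then obtain m where m: "4 * n - e = 2 * m + 1" by (elim oddE)
    have "d - (2 * m + 1) * -1 = (d - e) + 4 * n" using m by simp
    then have "4 * n dvd d - (2 * m + 1) * -1" using dvd by (metis dvd_add dvd_refl)
    then show ?thesis
      using False e m by (intro exI[of _ m] exI[of _ "-1"]) auto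
  qed
qed

text \<open>Each signed odd number here has absolute value at most \<open>2 * n - 1\<close>, so a
  difference divisible by \<open>4 * n\<close> is 0. As \<open>2 * m + 1\<close> is positive, sign
  and size can then be read off.\<close>

lemma odd_residue_unique:
  fixes n m m' s s' :: int
  assumes "0 \<le> m" "m < n" "0 \<le> m'" "m' < n" "s \<in> {1, -1}" "s' \<in> {1, -1}"
    and dvd: "4 * n dvd (2 * m + 1) * s - (2 * m' + 1) * s'"
  shows "m = m' \<and> s = s'"
proof -
  have "\<bar>(2 * m + 1) * s - (2 * m' + 1) * s'\<bar> < 4 * n"
    using assms(1-6) by auto
  then have "(2 * m + 1) * s - (2 * m' + 1) * s' = 0"
    using dvd dvd_imp_le_int by (smt (verit))
  then show ?thesis
    using assms(1-6) by auto
qed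

text \<open>One neighbour per colour is the count that biasedness asks for. It also makes every
  colour occur, so the fibres are nonempty and pairwise distinct.\<close>

lemma biased_partition_of_colouring:
  fixes c :: "int ^ 'n::finite \<Rightarrow> nat"
  assumes range: "\<And>x. c x \<in> {1..2 * CARD('n)}"
    and unique: "\<And>x i. i \<in> {1..2 * CARD('n)} \<Longrightarrow> \<exists>!y. y \<in> nbhd x \<and> c y = i"
  shows "biased_partition (\<lambda>i. {x. c x = i})"
  unfolding biased_partition_def
proof (intro conjI ballI)
  have nonempty: "\<exists>x. c x = i" if "i \<in> {1..2 * CARD('n)}" for i
    using unique[OF that] by blast
  then show "inj_on (\<lambda>i. {x. c x = i}) {1..2 * CARD('n)}"
    by (intro inj_onI) blast
  show "partition_on UNIV ((\<lambda>i. {x. c x = i}) ` {1..2 * CARD('n)})"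
  proof (rule partition_onI)
    show "{} \<notin> (\<lambda>i. {x. c x = i}) ` {1..2 * CARD('n)}"
      using nonempty by blast
  qed (use range in \<open>auto simp: disjnt_def\<close>)
  show "is_biased (1 / (2 * real CARD('n))) {x. c x = i}"
    if i: "i \<in> {1..2 * CARD('n)}" for i
    unfolding is_biased_def
  proof
    fix x :: "int ^ 'n"
    obtain y where "nbhd x \<inter> {x. c x = i} = {y}"
      using unique[OF i, of x] by blast
    then show "real (card (nbhd x \<inter> {x. c x = i}))
        = 2 * (1 / (2 * real CARD('n))) * real CARD('n)"
      by simp
  qed
qed

theorem theorem3p1:
  shows "\<exists>X :: nat \<Rightarrow> (int ^ 'n::finite) set.
           biased_partition X \<and>
           (\<forall>x. \<forall>i\<in>{1..2 * CARD('n)}. \<exists>!y. y \<in> nbhd x \<and> y \<in> X i)"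
proof -
  define n where "n = int CARD('n)"
  have n: "n > 0" by (simp add: n_def)
  obtain f :: "'n \<Rightarrow> nat" where f: "bij_betw f UNIV {0..<CARD('n)}"
    using ex_bij_betw_finite_nat[OF finite_class.finite_UNIV] by blast
  have f_less: "int (f i) < n" for i
    using f by (auto simp: n_def bij_betw_def)
  define h :: "int ^ 'n \<Rightarrow> int" where "h x = (\<Sum>i\<in>UNIV. (2 * int (f i) + 1) * x $ i)" for x
  have h_step: "h (x + axis i s) = h x + (2 * int (f i) + 1) * s" for x i s
    unfolding h_def by (rule sum_mult_add_axis)
  \<comment> \<open>Halving merges the residues \<open>2 * k\<close> and \<open>2 * k + 1\<close>;
    adding 1 shifts the colours to start at 1.\<close>
  define c where "c x = nat (h x mod (4 * n) div 2) + 1" for x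
  have h_mod: "0 \<le> h x mod (4 * n)" "h x mod (4 * n) < 4 * n" for x
    using n by simp_all
  have c_range: "c x \<in> {1..2 * CARD('n)}" for x
  proof -
    have "h x mod (4 * n) div 2 < 2 * n" using h_mod[of x] by linarith
    then have "nat (h x mod (4 * n) div 2) < 2 * CARD('n)"
      using h_mod(1)[of x] by (subst nat_less_iff) (simp_all add: n_def)
    then show ?thesis by (simp add: c_def)
  qed
  have c_unique: "\<exists>!y. y \<in> nbhd x \<and> c y = k" if k: "k \<in> {1..2 * CARD('n)}" for x k
  proof -
    \<comment> \<open>Of the two residues with colour \<open>k\<close>, \<open>r\<close> is the one
      whose parity is opposite to that of \<open>h x\<close>.\<close>
    define r where "r = 2 * (int k - 1) + (if even (h x) then 1 else 0)"
    have r: "0 \<le> r" "r < 4 * n" "odd (r - h x)" "nat (r div 2) + 1 = k"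
      using k by (auto simp: r_def n_def)
    have colour: "c y = k \<longleftrightarrow> 4 * n dvd r - h y" if "y \<in> nbhd x" for y
    proof
      assume "4 * n dvd r - h y"
      then have "h y mod (4 * n) = r"
        using r by (metis mod_eq_dvd_iff mod_pos_pos_trivial)
      then show "c y = k" using r by (simp add: c_def)
    next
      assume ck: "c y = k"
      \<comment> \<open>A step changes \<open>h\<close> by an odd number, and reduction modulo the
        even \<open>4 * n\<close> keeps parity, so the other residue of colour \<open>k\<close> is
        excluded.\<close>
      have "odd (h y - h x)"
        using that by (auto simp: in_nbhd_iff h_step)
      then have "even (h y mod (4 * n)) \<longleftrightarrow> odd (h x)"
        by (auto simp: dvd_mod_iff)
      moreover have "h y mod (4 * n) div 2 = int k - 1"
        using ck h_mod(1)[of y] by (auto simp: c_def)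
      moreover have "h y mod (4 * n) = 2 * (h y mod (4 * n) div 2) + h y mod (4 * n) mod 2"
        by simp
      ultimately have "h y mod (4 * n) = r"
        unfolding r_def by (metis even_iff_mod_2_eq_zero odd_iff_mod_2_eq_one)
      then show "4 * n dvd r - h y"
        by (metis mod_eq_dvd_iff mod_mod_trivial)
    qed
    obtain m s where m: "0 \<le> m" "m < n" and s: "s \<in> {1, -1}"
      and dvd: "4 * n dvd (r - h x) - (2 * m + 1) * s"
      using odd_residue_exists[OF n r(3)] by blast
    have "nat m \<in> range f"
      using f m by (auto simp: bij_betw_def n_def)
    then obtain i where i: "int (f i) = m"
      using m by (metis imageE int_nat_eq)
    show ?thesis
    proof (rule ex1I)
      have "x + axis i s \<in> nbhd x"
        using s by (auto simp: in_nbhd_iff)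
      moreover from this have "c (x + axis i s) = k"
        using dvd i by (simp add: colour h_step algebra_simps)
      ultimately show "x + axis i s \<in> nbhd x \<and> c (x + axis i s) = k" ..
    next
      fix y
      assume y: "y \<in> nbhd x \<and> c y = k"
      then obtain j t where t: "t \<in> {1, -1}" and y_eq: "y = x + axis j t"
        by (auto simp: in_nbhd_iff)
      have "4 * n dvd (r - h x) - (2 * int (f j) + 1) * t"
        using y colour[of y] by (simp add: y_eq h_step algebra_simps)
      \<comment> \<open>Subtraction cancels \<open>r - h x\<close> and leaves two signed odd numbers
        congruent modulo \<open>4 * n\<close>.\<close>
      from dvd_diff[OF this dvd]
      have "4 * n dvd (2 * m + 1) * s - (2 * int (f j) + 1) * t"
        by (simp add: algebra_simps)
      then have "m = int (f j) \<and> s = t"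
        using m s t f_less by (intro odd_residue_unique) auto
      moreover have "inj f" using f by (simp add: bij_betw_def)
      ultimately show "y = x + axis i s"
        using i y_eq by (auto dest: injD)
    qed
  qed
  from c_range c_unique have "biased_partition (\<lambda>i. {x. c x = i})"
    by (rule biased_partition_of_colouring)
  with c_unique show ?thesis by (intro exI[of _ "\<lambda>i. {x. c x = i}"]) simp
qed

end
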